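(* Let $Z$ be a topological space. The following statements are equivalent: (i) $Z$ is up-spectral. (ii) $Z$ is homeomorphic to the prime spectrum of a distributive lattice with minimum.
   Context: An irreducible closed set is a non-empty closed set $F$ such that $F=G\cup H$ with $G,H$ closed implies $F=G$ or $F=H$. A space is sober if every irreducible closed set is the closure of a unique point. A space is coherent if it has a basis of open compact sets that is closed under finite (non-empty) intersections (compactness does not include Hausdorff). A space is up-spectral if it is coherent and sober. A lattice is a non-empty poset with binary joins and meets (a maximum is not required). An ideal is a non-empty lower subset closed under finite non-empty joins. A proper ideal $I$ is prime if $a\wedge b\in I$ implies $a\in I$ or $b\in I$. The prime spectrum of a lattice $L$ is the set of its prime ideals with the topology whose basic open sets are $d(a)=\{I : I\text{ a prime ideal of }L,\ a\notin I\}$, $a\in L$. *)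

theory Defs
  imports "HOL-Analysis.Analysis" "HOL-Algebra.Lattice"
begin

section \<open>Up-spectral spaces\<close>

definition irreducible_closedin :: "'a topology \<Rightarrow> 'a set \<Rightarrow> bool" where
  "irreducible_closedin X F \<longleftrightarrow>
     closedin X F \<and> F \<noteq> {} \<and>
     (\<forall>G H. closedin X G \<and> closedin X H \<and> F = G \<union> H \<longrightarrow> F = G \<or> F = H)"

definition sober_space :: "'a topology \<Rightarrow> bool" where
  "sober_space X \<longleftrightarrow>
     (\<forall>F. irreducible_closedin X F \<longrightarrow>
        (\<exists>!x. x \<in> topspace X \<and> F = X closure_of {x}))"

text \<open>The whole space need not be compact: only non-empty intersections are required to stay
  in the basis.\<close>

definition coherent_space :: "'a topology \<Rightarrow> bool" where
  "coherent_space X \<longleftrightarrow>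
     (\<exists>\<B>. openin X = arbitrary union_of (\<lambda>U. U \<in> \<B>) \<and>
          (\<forall>U\<in>\<B>. compactin X U) \<and>
          (\<forall>\<F>. finite \<F> \<and> \<F> \<noteq> {} \<and> \<F> \<subseteq> \<B> \<longrightarrow> \<Inter>\<F> \<in> \<B>))"

definition up_spectral_space :: "'a topology \<Rightarrow> bool" where
  "up_spectral_space X \<longleftrightarrow> coherent_space X \<and> sober_space X"


section \<open>The prime spectrum of a lattice\<close>

text \<open>The existence of a minimum makes the carrier non-empty; a maximum is not required.\<close>

locale distributive_lattice_bottom = lattice L + weak_partial_order_bottom L
  for L (structure) +
  assumes meet_join_distrib:
    "\<lbrakk>x \<in> carrier L; y \<in> carrier L; z \<in> carrier L\<rbrakk>
      \<Longrightarrow> x \<sqinter> (y \<squnion> z) = (x \<sqinter> y) \<squnion> (x \<sqinter> z)"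

definition lattice_ideal :: "('a, 'm) gorder_scheme \<Rightarrow> 'a set \<Rightarrow> bool" where
  "lattice_ideal L I \<longleftrightarrow>
     I \<subseteq> carrier L \<and> I \<noteq> {} \<and>
     (\<forall>x\<in>I. \<forall>y\<in>carrier L. y \<sqsubseteq>\<^bsub>L\<^esub> x \<longrightarrow> y \<in> I) \<and>
     (\<forall>A. finite A \<and> A \<noteq> {} \<and> A \<subseteq> I \<longrightarrow> \<Squnion>\<^bsub>L\<^esub>A \<in> I)"

definition prime_lattice_ideal :: "('a, 'm) gorder_scheme \<Rightarrow> 'a set \<Rightarrow> bool" where
  "prime_lattice_ideal L I \<longleftrightarrow>
     lattice_ideal L I \<and> I \<noteq> carrier L \<and>
     (\<forall>a\<in>carrier L. \<forall>b\<in>carrier L. a \<sqinter>\<^bsub>L\<^esub> b \<in> I \<longrightarrow> a \<in> I \<or> b \<in> I)"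

definition spectrum_basic_open :: "('a, 'm) gorder_scheme \<Rightarrow> 'a \<Rightarrow> 'a set set" where
  "spectrum_basic_open L a = {I. prime_lattice_ideal L I \<and> a \<notin> I}"

definition prime_spectrum :: "('a, 'm) gorder_scheme \<Rightarrow> 'a set topology" where
  "prime_spectrum L =
     topology (arbitrary union_of (\<lambda>U. U \<in> spectrum_basic_open L ` carrier L))"

lemma lattice_ideal_downward:
  assumes "lattice_ideal L I" "x \<in> I" "y \<in> carrier L" "y \<sqsubseteq>\<^bsub>L\<^esub> x"
  shows "y \<in> I"
  using assms by (simp add: lattice_ideal_def)

lemma spectrum_basic_open_Int:
  assumes "lattice L" "a \<in> carrier L" "b \<in> carrier L"
  shows "spectrum_basic_open L a \<inter> spectrum_basic_open L b = spectrum_basic_open L (a \<sqinter>\<^bsub>L\<^esub> b)"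
proof -
  interpret lattice L by fact
  have meet: "a \<sqinter>\<^bsub>L\<^esub> b \<in> carrier L" "a \<sqinter>\<^bsub>L\<^esub> b \<sqsubseteq>\<^bsub>L\<^esub> a" "a \<sqinter>\<^bsub>L\<^esub> b \<sqsubseteq>\<^bsub>L\<^esub> b"
    using assms(2,3) by (simp_all add: meet_left meet_right)
  have "a \<sqinter>\<^bsub>L\<^esub> b \<in> I \<longleftrightarrow> a \<in> I \<or> b \<in> I" if I: "prime_lattice_ideal L I" for I
  proof
    show "a \<sqinter>\<^bsub>L\<^esub> b \<in> I \<Longrightarrow> a \<in> I \<or> b \<in> I"
      using I assms(2,3) by (simp add: prime_lattice_ideal_def)
    have "lattice_ideal L I"
      using I by (simp add: prime_lattice_ideal_def)
    then show "a \<in> I \<or> b \<in> I \<Longrightarrow> a \<sqinter>\<^bsub>L\<^esub> b \<in> I"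
      using lattice_ideal_downward meet by metis
  qed
  then show ?thesis
    by (auto simp: spectrum_basic_open_def)
qed

text \<open>\<^const>\<open>topology\<close> is only meaningful on families satisfying \<^const>\<open>istopology\<close>; for a
  lattice this is the case, so that the sets \<^term>\<open>spectrum_basic_open L a\<close> form a basis.\<close>

lemma openin_prime_spectrum:
  assumes "lattice L"
  shows "openin (prime_spectrum L) =
           arbitrary union_of (\<lambda>U. U \<in> spectrum_basic_open L ` carrier L)"
proof -
  interpret lattice L by fact
  have "istopology (arbitrary union_of (\<lambda>U. U \<in> spectrum_basic_open L ` carrier L))"
  proof (rule istopology_base)
    fix S T
    assume "S \<in> spectrum_basic_open L ` carrier L" "T \<in> spectrum_basic_open L ` carrier L"
    then show "S \<inter> T \<in> spectrum_basic_open L ` carrier L"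
      using spectrum_basic_open_Int[OF assms] by auto
  qed
  then show ?thesis
    unfolding prime_spectrum_def by (rule topology_inverse')
qed

lemma topspace_prime_spectrum:
  assumes "lattice L"
  shows "topspace (prime_spectrum L) = {I. prime_lattice_ideal L I}"
proof (rule subset_antisym)
  show "topspace (prime_spectrum L) \<subseteq> {I. prime_lattice_ideal L I}"
  proof
    fix I
    assume "I \<in> topspace (prime_spectrum L)"
    then obtain a where "I \<in> spectrum_basic_open L a"
      unfolding topspace_def openin_prime_spectrum[OF assms] union_of_def arbitrary_def by auto
    then show "I \<in> {I. prime_lattice_ideal L I}"
      by (simp add: spectrum_basic_open_def)
  qed
  show "{I. prime_lattice_ideal L I} \<subseteq> topspace (prime_spectrum L)"
  proof
    fix I
    assume I: "I \<in> {I. prime_lattice_ideal L I}"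
    then have "I \<subseteq> carrier L" "I \<noteq> carrier L"
      by (simp_all add: prime_lattice_ideal_def lattice_ideal_def)
    then obtain a where a: "a \<in> carrier L" "a \<notin> I"
      by auto
    then have "openin (prime_spectrum L) (spectrum_basic_open L a)"
      unfolding openin_prime_spectrum[OF assms] by (simp add: arbitrary_union_of_inc)
    moreover have "I \<in> spectrum_basic_open L a"
      using I a by (simp add: spectrum_basic_open_def)
    ultimately show "I \<in> topspace (prime_spectrum L)"
      using openin_subset by auto
  qed
qed

end

theory Submission
  imports Defs
begin

text \<open>The spectrum of a distributive lattice is up-spectral: its basic open sets are compact by the
  prime ideal theorem, and an irreducible closed set \<open>F\<close> is the closure of the prime ideal of all
  \<open>a\<close> with \<open>d(a) \<inter> F = \<emptyset>\<close>. Conversely, in an up-spectral space the compact open sets form a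
  distributive lattice, and sending a point to the ideal of all compact open sets that miss it is a
  homeomorphism onto the spectrum: the complement of the union of a prime ideal is irreducible, and
  its generic point is the preimage.\<close>

section \<open>Ideals of lattices\<close>

text \<open>Induction over a non-empty finite set: x \<squnion> \<Squnion>F is an upper bound of
  \<open>insert x F\<close>, so the supremum of \<open>insert x F\<close> lies below it. This
  inequality suffices because \<open>I\<close> is downward closed. All later ideal checks then need
  only binary joins.\<close>

lemma lattice_ideal_iff:
  assumes "lattice L"
  shows "lattice_ideal L I \<longleftrightarrow> I \<subseteq> carrier L \<and> I \<noteq> {} \<and>
    (\<forall>x\<in>I. \<forall>y\<in>carrier L. y \<sqsubseteq>\<^bsub>L\<^esub> x \<longrightarrow> y \<in> I) \<and> (\<forall>x\<in>I. \<forall>y\<in>I. x \<squnion>\<^bsub>L\<^esub> y \<in> I)"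
    (is "_ \<longleftrightarrow> ?R")
proof
  assume "lattice_ideal L I"
  then show ?R
    by (auto simp: lattice_ideal_def join_def)
next
  interpret lattice L by fact
  assume R: ?R
  have "\<Squnion>\<^bsub>L\<^esub>A \<in> I" if "finite A" "A \<noteq> {}" "A \<subseteq> I" for A
    using that
  proof (induction rule: finite_ne_induct)
    case (singleton x)
    then have x: "x \<in> carrier L" "x \<in> I" using R by auto
    have "\<Squnion>\<^bsub>L\<^esub>{x} = x"
      using weak_sup_of_singleton[OF x(1)] by (simp add: eq_is_equal)
    then show ?case using x by simp
  next
    case (insert x F)
    have car: "x \<in> carrier L" "F \<subseteq> carrier L" and F: "\<Squnion>\<^bsub>L\<^esub>F \<in> I" "x \<in> I"
      using insert R by auto
    have Fc: "\<Squnion>\<^bsub>L\<^esub>F \<in> carrier L" using F R by auto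
    have lub: "least L (\<Squnion>\<^bsub>L\<^esub>F) (Upper L F)"
      using finite_sup_least insert car by simp
    have "\<Squnion>\<^bsub>L\<^esub>(insert x F) \<sqsubseteq>\<^bsub>L\<^esub> x \<squnion>\<^bsub>L\<^esub> \<Squnion>\<^bsub>L\<^esub>F"
    proof (rule least_le[OF finite_sup_least], use insert car in \<open>simp_all\<close>)
      show "x \<squnion>\<^bsub>L\<^esub> \<Squnion>\<^bsub>L\<^esub>F \<in> Upper L (insert x F)"
      proof (rule Upper_memI)
        fix z assume "z \<in> insert x F"
        then show "z \<sqsubseteq>\<^bsub>L\<^esub> x \<squnion>\<^bsub>L\<^esub> \<Squnion>\<^bsub>L\<^esub>F"
        proof
          assume "z \<in> F"
          then have "z \<sqsubseteq>\<^bsub>L\<^esub> \<Squnion>\<^bsub>L\<^esub>F" "z \<in> carrier L"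
            using least_Upper_above[OF lub] car by auto
          then show ?thesis
            using le_trans[OF _ join_right[OF car(1) Fc]] car Fc by simp
        qed (use join_left car Fc in auto)
      qed (use car Fc in auto)
    qed
    moreover have "x \<squnion>\<^bsub>L\<^esub> \<Squnion>\<^bsub>L\<^esub>F \<in> I" using R F by blast
    moreover have "\<Squnion>\<^bsub>L\<^esub>(insert x F) \<in> carrier L"
      using insert car by (intro finite_sup_closed) auto
    ultimately show ?case using R by blast
  qed
  then show "lattice_ideal L I"
    using R by (simp add: lattice_ideal_def)
qed

lemma lattice_ideal_join:
  assumes "lattice_ideal L I" "x \<in> I" "y \<in> I"
  shows "x \<squnion>\<^bsub>L\<^esub> y \<in> I"
  using assms by (auto simp: lattice_ideal_def join_def)

text \<open>Two elements of the union lie in a common member of the chain, and that member contains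
  their join. This supplies the upper bounds for Zorn's lemma.\<close>

lemma lattice_ideal_Union_chain:
  assumes "lattice L" "C \<noteq> {}" "\<And>I. I \<in> C \<Longrightarrow> lattice_ideal L I"
    and chain: "\<And>I J. I \<in> C \<Longrightarrow> J \<in> C \<Longrightarrow> I \<subseteq> J \<or> J \<subseteq> I"
  shows "lattice_ideal L (\<Union>C)"
proof -
  note id = assms(3)[unfolded lattice_ideal_iff[OF assms(1)]]
  have "x \<squnion>\<^bsub>L\<^esub> y \<in> \<Union>C" if "x \<in> I" "I \<in> C" "y \<in> J" "J \<in> C" for x y I J
    using that chain[of I J] id by blast
  moreover have "\<Union>C \<noteq> {}"
    using id assms(2) by auto
  moreover have "\<Union>C \<subseteq> carrier L"
    using id by (simp add: Union_least)
  moreover have "y \<in> \<Union>C" if "x \<in> \<Union>C" "y \<in> carrier L" "y \<sqsubseteq>\<^bsub>L\<^esub> x" for x y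
    using that id by auto
  ultimately show ?thesis
    unfolding lattice_ideal_iff[OF assms(1)] by auto
qed

section \<open>Extending ideals and the prime ideal theorem\<close>

context distributive_lattice_bottom
begin

lemma join_mono:
  assumes "x \<sqsubseteq> x'" "y \<sqsubseteq> y'" "x \<in> carrier L" "x' \<in> carrier L" "y \<in> carrier L" "y' \<in> carrier L"
  shows "x \<squnion> y \<sqsubseteq> x' \<squnion> y'"
proof (rule join_le)
  show "x \<sqsubseteq> x' \<squnion> y'"
    using le_trans[OF assms(1) join_left] assms by simp
  show "y \<sqsubseteq> x' \<squnion> y'"
    using le_trans[OF assms(2) join_right] assms by simp
qed (use assms in simp_all)

text \<open>Half of the dual distributive law. The left side expands by
  \<open>meet_join_distrib\<close> into the terms (r \<squnion> x) \<sqinter> r, y \<sqinter> r and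
  y \<sqinter> x, each of which lies below the right side. Distributivity enters the prime ideal
  theorem through this inequality.\<close>

lemma join_meet_le:
  assumes "r \<in> carrier L" "x \<in> carrier L" "y \<in> carrier L"
  shows "(r \<squnion> x) \<sqinter> (r \<squnion> y) \<sqsubseteq> r \<squnion> (x \<sqinter> y)"
proof -
  have c: "r \<squnion> x \<in> carrier L" "x \<sqinter> y \<in> carrier L" "r \<squnion> (x \<sqinter> y) \<in> carrier L"
    using assms by auto
  have "(r \<squnion> x) \<sqinter> (r \<squnion> y) = ((r \<squnion> x) \<sqinter> r) \<squnion> ((r \<squnion> x) \<sqinter> y)"
    using meet_join_distrib[OF c(1) assms(1,3)] .
  also have "(r \<squnion> x) \<sqinter> y = (y \<sqinter> r) \<squnion> (y \<sqinter> x)"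
    unfolding meet_comm[of L "r \<squnion> x" y] using meet_join_distrib[OF assms(3,1,2)] .
  also have "((r \<squnion> x) \<sqinter> r) \<squnion> ((y \<sqinter> r) \<squnion> (y \<sqinter> x)) \<sqsubseteq> r \<squnion> (x \<sqinter> y)"
  proof (intro join_le)
    show "(r \<squnion> x) \<sqinter> r \<sqsubseteq> r \<squnion> (x \<sqinter> y)" "y \<sqinter> r \<sqsubseteq> r \<squnion> (x \<sqinter> y)"
      using assms c by (auto intro: le_trans[OF meet_right join_left])
    show "y \<sqinter> x \<sqsubseteq> r \<squnion> (x \<sqinter> y)"
      unfolding meet_comm[of L y x] using join_right[OF assms(1) c(2)] .
  qed (use assms c in auto)
  finally show ?thesis .
qed

text \<open>The set is the ideal generated by \<open>I\<close> and \<open>x\<close>. For elements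
  below p \<squnion> x and q \<squnion> x, the witness for their join is p \<squnion> q, which is
  again in \<open>I\<close>.\<close>

lemma lattice_ideal_adjoin:
  assumes I: "lattice_ideal L I" and x: "x \<in> carrier L"
  shows "lattice_ideal L {z \<in> carrier L. \<exists>p\<in>I. z \<sqsubseteq> p \<squnion> x}" (is "lattice_ideal L ?J")
    and "insert x I \<subseteq> {z \<in> carrier L. \<exists>p\<in>I. z \<sqsubseteq> p \<squnion> x}"
proof -
  note Ii = I[unfolded lattice_ideal_iff[OF lattice_axioms]]
  obtain p where p: "p \<in> I" "p \<in> carrier L" using Ii by blast
  have "y \<in> ?J" if "y \<in> I" for y
    using that Ii x by (auto intro!: bexI[of _ y] join_left)
  moreover have "x \<in> ?J"
    using p x by (auto intro!: bexI[of _ p] join_right)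
  ultimately show sub: "insert x I \<subseteq> ?J" by blast
  show "lattice_ideal L ?J"
    unfolding lattice_ideal_iff[OF lattice_axioms]
  proof (intro conjI ballI impI)
    fix u v assume "u \<in> ?J" "v \<in> ?J"
    then obtain p q where pq: "p \<in> I" "u \<sqsubseteq> p \<squnion> x" "u \<in> carrier L"
      "q \<in> I" "v \<sqsubseteq> q \<squnion> x" "v \<in> carrier L" by blast
    have c: "p \<in> carrier L" "q \<in> carrier L" using pq Ii by auto
    have r: "p \<squnion> q \<in> I" using pq lattice_ideal_join[OF I] by blast
    then have r_car: "p \<squnion> q \<in> carrier L" using Ii by blast
    have "p \<squnion> x \<sqsubseteq> (p \<squnion> q) \<squnion> x" "q \<squnion> x \<sqsubseteq> (p \<squnion> q) \<squnion> x"
      using c r_car x by (simp_all add: join_mono join_left join_right)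
    then have "u \<squnion> v \<sqsubseteq> (p \<squnion> q) \<squnion> x"
      using join_le[OF le_trans[OF pq(2)] le_trans[OF pq(5)]] pq(3,6) c r_car x by simp
    then show "u \<squnion> v \<in> ?J" using pq r by auto
  next
    fix u v assume "u \<in> ?J" "v \<in> carrier L" "v \<sqsubseteq> u"
    then obtain p where p: "p \<in> I" "u \<sqsubseteq> p \<squnion> x" "u \<in> carrier L" by blast
    have "p \<squnion> x \<in> carrier L" using p Ii x join_closed by blast
    then have "v \<sqsubseteq> p \<squnion> x"
      using le_trans[OF \<open>v \<sqsubseteq> u\<close> p(2) \<open>v \<in> carrier L\<close> p(3)] by simp
    then show "v \<in> ?J" using p \<open>v \<in> carrier L\<close> by blast
  qed (use sub in auto)
qed

text \<open>Zorn's lemma gives an ideal \<open>P\<close> that is maximal among the ideals containing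
  \<open>J\<close> and missing \<open>a\<close>. Distributivity makes it prime: if \<open>x\<close>
  and \<open>y\<close> lie outside \<open>P\<close>, then adjoining either one captures
  \<open>a\<close>, and hence \<open>P\<close> together with x \<sqinter> y would generate an ideal
  containing \<open>a\<close>.\<close>

theorem prime_ideal_separation:
  assumes J: "lattice_ideal L J" and a: "a \<in> carrier L" "a \<notin> J"
  obtains P where "prime_lattice_ideal L P" "J \<subseteq> P" "a \<notin> P"
proof -
  define \<A> where "\<A> = {I. lattice_ideal L I \<and> J \<subseteq> I \<and> a \<notin> I}"
  obtain P where P_in: "P \<in> \<A>" and P_max: "\<And>X. X \<in> \<A> \<Longrightarrow> P \<subseteq> X \<Longrightarrow> X = P"
  proof -
    have "\<exists>M\<in>\<A>. \<forall>X\<in>\<A>. M \<subseteq> X \<longrightarrow> X = M"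
    proof (rule subset_Zorn_nonempty)
      show "\<A> \<noteq> {}" using J a by (auto simp: \<A>_def)
      fix C assume "C \<noteq> {}" and ch: "subset.chain \<A> C"
      have "lattice_ideal L (\<Union>C)"
        using ch by (intro lattice_ideal_Union_chain[OF lattice_axioms \<open>C \<noteq> {}\<close>])
          (auto simp: subset_chain_def \<A>_def)
      then show "\<Union>C \<in> \<A>"
        using ch \<open>C \<noteq> {}\<close> unfolding subset_chain_def \<A>_def by blast
    qed
    then show thesis using that by meson
  qed
  have P: "lattice_ideal L P" "J \<subseteq> P" "a \<notin> P"
    using P_in by (simp_all add: \<A>_def)
  have max: "X = P" if "lattice_ideal L X" "P \<subseteq> X" "a \<notin> X" for X
    using that P(2) by (intro P_max) (auto simp: \<A>_def)
  note Pi = P(1)[unfolded lattice_ideal_iff[OF lattice_axioms]]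
  \<comment> \<open>Otherwise the ideal generated by \<open>P\<close> and \<open>x\<close> would
    still miss \<open>a\<close>, so it would equal \<open>P\<close> by maximality, although it
    contains \<open>x\<close>.\<close>
  have adj: "\<exists>p\<in>P. a \<sqsubseteq> p \<squnion> x" if "x \<in> carrier L" "x \<notin> P" for x
  proof (rule ccontr)
    assume *: "\<not> (\<exists>p\<in>P. a \<sqsubseteq> p \<squnion> x)"
    have "{z \<in> carrier L. \<exists>p\<in>P. z \<sqsubseteq> p \<squnion> x} = P"
      using * lattice_ideal_adjoin[OF P(1) that(1)] by (intro max) simp_all
    then show False
      using lattice_ideal_adjoin(2)[OF P(1) that(1)] that(2) by simp
  qed
  have "x \<in> P \<or> y \<in> P" if xy: "x \<in> carrier L" "y \<in> carrier L" "x \<sqinter> y \<in> P" for x y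
  proof (rule ccontr)
    assume "\<not> (x \<in> P \<or> y \<in> P)"
    then obtain p q where pq: "p \<in> P" "a \<sqsubseteq> p \<squnion> x" "q \<in> P" "a \<sqsubseteq> q \<squnion> y"
      using adj xy by meson
    \<comment> \<open>Replacing \<open>p\<close> and \<open>q\<close> by their join bounds
      \<open>a\<close> by two joins with the same first argument, which is the form that
      \<open>join_meet_le\<close> takes.\<close>
    have r: "p \<squnion> q \<in> P"
      using pq lattice_ideal_join[OF P(1)] by blast
    then have c: "p \<in> carrier L" "q \<in> carrier L" "p \<squnion> q \<in> carrier L"
      using pq Pi by blast+
    have "p \<squnion> x \<sqsubseteq> (p \<squnion> q) \<squnion> x" "q \<squnion> y \<sqsubseteq> (p \<squnion> q) \<squnion> y"
      using c xy by (simp_all add: join_mono join_left join_right)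
    then have "a \<sqsubseteq> (p \<squnion> q) \<squnion> x" "a \<sqsubseteq> (p \<squnion> q) \<squnion> y"
      using le_trans[OF pq(2)] le_trans[OF pq(4)] c xy a by simp_all
    then have "a \<sqsubseteq> ((p \<squnion> q) \<squnion> x) \<sqinter> ((p \<squnion> q) \<squnion> y)"
      using a c xy by (simp add: meet_le)
    then have "a \<sqsubseteq> (p \<squnion> q) \<squnion> (x \<sqinter> y)"
      using le_trans[OF _ join_meet_le[OF c(3) xy(1,2)]] a c xy by simp
    moreover have "(p \<squnion> q) \<squnion> (x \<sqinter> y) \<in> P"
      using lattice_ideal_join[OF P(1) r xy(3)] .
    ultimately show False using P(3) Pi a by blast
  qed
  then have "prime_lattice_ideal L P"
    using P(1,3) a(1) unfolding prime_lattice_ideal_def by auto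
  then show thesis by (rule that) (rule P)+
qed

section \<open>The prime spectrum is up-spectral\<close>

lemma bottom_in_lattice_ideal:
  assumes "lattice_ideal L I"
  shows "\<bottom> \<in> I"
proof -
  have "I \<noteq> {}" "I \<subseteq> carrier L"
    using assms by (simp_all add: lattice_ideal_def)
  then obtain x where "x \<in> I" "x \<in> carrier L" by blast
  then show ?thesis
    using lattice_ideal_downward[OF assms _ bottom_closed bottom_lower] by simp
qed

lemma spectrum_basic_open_bottom: "spectrum_basic_open L \<bottom> = {}"
  using bottom_in_lattice_ideal by (auto simp: spectrum_basic_open_def prime_lattice_ideal_def)

lemma spectrum_basic_open_mono:
  assumes "a \<sqsubseteq> b" "a \<in> carrier L"
  shows "spectrum_basic_open L a \<subseteq> spectrum_basic_open L b"
  using assms lattice_ideal_downward by (fastforce simp: spectrum_basic_open_def prime_lattice_ideal_def)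

lemma spectrum_basic_open_join:
  assumes "a \<in> carrier L" "b \<in> carrier L"
  shows "spectrum_basic_open L (a \<squnion> b) \<subseteq> spectrum_basic_open L a \<union> spectrum_basic_open L b"
  using lattice_ideal_join by (fastforce simp: spectrum_basic_open_def prime_lattice_ideal_def)

section \<open>The basic open sets as a basis of compact sets\<close>

lemma openin_spectrum_basic_open:
  assumes "a \<in> carrier L"
  shows "openin (prime_spectrum L) (spectrum_basic_open L a)"
  using assms unfolding openin_prime_spectrum[OF lattice_axioms] by (simp add: arbitrary_union_of_inc)

lemma prime_spectrum_base:
  assumes "openin (prime_spectrum L) U" "I \<in> U"
  obtains a where "a \<in> carrier L" "I \<in> spectrum_basic_open L a" "spectrum_basic_open L a \<subseteq> U"
  using assms openin_prime_spectrum[OF lattice_axioms] unfolding openin_topology_base_unique by blast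

text \<open>The elements whose basic open set has a finite subcover form an ideal \<open>J\<close>.
  If \<open>a\<close> were not in \<open>J\<close>, a prime ideal P \<supseteq> J missing
  \<open>a\<close> would be a point of \<open>d(a)\<close>. It would lie in some member of the
  cover, hence in some \<open>d(b)\<close> inside that member. Then \<open>b\<close> is in
  \<open>J\<close> because one set covers \<open>d(b)\<close>, yet \<open>b\<close> is not in
  \<open>P\<close>.\<close>

lemma compactin_spectrum_basic_open:
  assumes a: "a \<in> carrier L"
  shows "compactin (prime_spectrum L) (spectrum_basic_open L a)"
  unfolding compactin_def
proof (intro conjI allI impI)
  show "spectrum_basic_open L a \<subseteq> topspace (prime_spectrum L)"
    using openin_spectrum_basic_open[OF a] openin_subset by blast
  fix \<U> assume "Ball \<U> (openin (prime_spectrum L)) \<and> spectrum_basic_open L a \<subseteq> \<Union>\<U>"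
  then have \<U>: "\<And>U. U \<in> \<U> \<Longrightarrow> openin (prime_spectrum L) U" "spectrum_basic_open L a \<subseteq> \<Union>\<U>"
    by auto
  define J where "J = {x \<in> carrier L. \<exists>\<F>. finite \<F> \<and> \<F> \<subseteq> \<U> \<and> spectrum_basic_open L x \<subseteq> \<Union>\<F>}"
  have "lattice_ideal L J"
    unfolding lattice_ideal_iff[OF lattice_axioms]
  proof (intro conjI ballI impI)
    \<comment> \<open>The basic open set of the minimum is empty, so the empty subfamily covers
      it.\<close>
    have "\<bottom> \<in> J"
      unfolding J_def using spectrum_basic_open_bottom bottom_closed by blast
    then show "J \<noteq> {}" by blast
    show "J \<subseteq> carrier L" by (auto simp: J_def)
    show "y \<in> J" if "x \<in> J" "y \<in> carrier L" "y \<sqsubseteq> x" for x y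
      using that spectrum_basic_open_mono[of y x] unfolding J_def by blast
    fix x y assume "x \<in> J" "y \<in> J"
    then obtain \<F> \<G> where "finite (\<F> \<union> \<G>)" "\<F> \<union> \<G> \<subseteq> \<U>" "x \<in> carrier L" "y \<in> carrier L"
      "spectrum_basic_open L x \<subseteq> \<Union>\<F>" "spectrum_basic_open L y \<subseteq> \<Union>\<G>"
      unfolding J_def by (auto simp del: Union_iff)
    moreover from this have "spectrum_basic_open L (x \<squnion> y) \<subseteq> \<Union>(\<F> \<union> \<G>)"
      using spectrum_basic_open_join by blast
    ultimately show "x \<squnion> y \<in> J" unfolding J_def by (auto intro!: exI[of _ "\<F> \<union> \<G>"])
  qed
  have "a \<in> J"
  proof (rule ccontr)
    assume "a \<notin> J"
    then obtain P where P: "prime_lattice_ideal L P" "J \<subseteq> P" "a \<notin> P"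
      using prime_ideal_separation[OF \<open>lattice_ideal L J\<close> a] by blast
    then obtain U where U: "U \<in> \<U>" "P \<in> U"
      using \<U>(2) by (auto simp: spectrum_basic_open_def)
    then obtain b where b: "b \<in> carrier L" "P \<in> spectrum_basic_open L b" "spectrum_basic_open L b \<subseteq> U"
      using prime_spectrum_base[OF \<U>(1)] by metis
    have "b \<in> J"
      unfolding J_def using b U by (intro CollectI conjI exI[of _ "{U}"]) auto
    then show False using b P by (auto simp: spectrum_basic_open_def)
  qed
  then show "\<exists>\<F>. finite \<F> \<and> \<F> \<subseteq> \<U> \<and> spectrum_basic_open L a \<subseteq> \<Union>\<F>"
    by (auto simp: J_def)
qed

lemma coherent_prime_spectrum: "coherent_space (prime_spectrum L)"
  unfolding coherent_space_def
proof (intro exI conjI ballI allI impI)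
  let ?B = "spectrum_basic_open L ` carrier L"
  show "openin (prime_spectrum L) = arbitrary union_of (\<lambda>U. U \<in> ?B)"
    using openin_prime_spectrum[OF lattice_axioms] .
  show "compactin (prime_spectrum L) U" if "U \<in> ?B" for U
    using that compactin_spectrum_basic_open by blast
  fix \<F> assume "finite \<F> \<and> \<F> \<noteq> {} \<and> \<F> \<subseteq> ?B"
  then have "finite \<F>" "\<F> \<noteq> {}" "\<F> \<subseteq> ?B" by auto
  then show "\<Inter>\<F> \<in> ?B"
  \<comment> \<open>The induction starts at singletons: in a lattice without maximum, the empty
    intersection, which is the whole space, need not be a basic open set.\<close>
  proof (induction rule: finite_ne_induct)
    case (insert U \<F>)
    then obtain a b where "a \<in> carrier L" "b \<in> carrier L"
      "U = spectrum_basic_open L a" "\<Inter>\<F> = spectrum_basic_open L b" by auto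
    then show ?case
      using spectrum_basic_open_Int[OF lattice_axioms] by simp
  qed simp
qed

section \<open>Closures of points and sobriety\<close>

lemma closure_of_prime_spectrum:
  assumes "prime_lattice_ideal L I"
  shows "prime_spectrum L closure_of {I} = {J. prime_lattice_ideal L J \<and> I \<subseteq> J}"
proof -
  \<comment> \<open>It suffices to look at a basic neighbourhood \<open>d(a)\<close> of
    \<open>J\<close>: since I \<subseteq> J, an element \<open>a\<close> outside \<open>J\<close> is
    also outside \<open>I\<close>.\<close>
  have "I \<in> U" if "prime_lattice_ideal L J" "I \<subseteq> J" "openin (prime_spectrum L) U" "J \<in> U" for J U
  proof -
    obtain a where "J \<in> spectrum_basic_open L a" "spectrum_basic_open L a \<subseteq> U"
      using prime_spectrum_base \<open>openin (prime_spectrum L) U\<close> \<open>J \<in> U\<close> by metis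
    then show ?thesis using that assms by (auto simp: spectrum_basic_open_def)
  qed
  moreover have "I \<subseteq> J" if J: "prime_lattice_ideal L J"
    and cl: "\<And>U. J \<in> U \<Longrightarrow> openin (prime_spectrum L) U \<Longrightarrow> I \<in> U" for J
  proof
    fix a assume "a \<in> I"
    then have "a \<in> carrier L"
      using assms by (auto simp: prime_lattice_ideal_def lattice_ideal_def)
    then show "a \<in> J"
      using cl[OF _ openin_spectrum_basic_open, of a] J \<open>a \<in> I\<close> by (auto simp: spectrum_basic_open_def)
  qed
  ultimately show ?thesis
    unfolding closure_of_def topspace_prime_spectrum[OF lattice_axioms] by (intro Collect_cong) auto
qed

lemma sober_prime_spectrum: "sober_space (prime_spectrum L)"
  unfolding sober_space_def
proof (intro allI impI)
  let ?X = "prime_spectrum L"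
  have top: "topspace ?X = {I. prime_lattice_ideal L I}"
    using topspace_prime_spectrum[OF lattice_axioms] .
  fix F assume "irreducible_closedin ?X F"
  then have F: "closedin ?X F" "F \<noteq> {}"
    and irr: "\<And>G H. closedin ?X G \<Longrightarrow> closedin ?X H \<Longrightarrow> F = G \<union> H \<Longrightarrow> F = G \<or> F = H"
    by (auto simp: irreducible_closedin_def)
  have Fp: "prime_lattice_ideal L J" if "J \<in> F" for J
    using closedin_subset[OF F(1)] that top by blast
  \<comment> \<open>As \<open>F\<close> consists of prime ideals, \<open>I\<close> is the
    intersection of all members of \<open>F\<close>. This is forced, since the closure of a point
    consists of the prime ideals above it.\<close>
  define I where "I = {a \<in> carrier L. spectrum_basic_open L a \<inter> F = {}}"
  have I_ideal: "lattice_ideal L I"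
    unfolding lattice_ideal_iff[OF lattice_axioms]
  proof (intro conjI ballI impI)
    have "\<bottom> \<in> I"
      using spectrum_basic_open_bottom bottom_closed by (auto simp: I_def)
    then show "I \<noteq> {}" by blast
    show "I \<subseteq> carrier L" by (auto simp: I_def)
    show "y \<in> I" if "x \<in> I" "y \<in> carrier L" "y \<sqsubseteq> x" for x y
      using that spectrum_basic_open_mono[of y x] unfolding I_def by blast
    show "x \<squnion> y \<in> I" if "x \<in> I" "y \<in> I" for x y
      using that spectrum_basic_open_join[of x y] unfolding I_def by auto
  qed
  have mem: "a \<in> J" if "J \<in> F" "a \<in> I" for a J
    using that Fp unfolding I_def spectrum_basic_open_def by blast
  \<comment> \<open>\<open>F\<close> has a member, and \<open>I\<close> is contained in that proper
    ideal.\<close>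
  have "I \<noteq> carrier L"
    using F(2) Fp mem unfolding prime_lattice_ideal_def lattice_ideal_def by blast
  moreover have "a \<in> I \<or> b \<in> I" if ab: "a \<in> carrier L" "b \<in> carrier L" "a \<sqinter> b \<in> I" for a b
  proof -
    \<comment> \<open>Because a \<sqinter> b is in \<open>I\<close>, no point of \<open>F\<close>
      lies in both \<open>d(a)\<close> and \<open>d(b)\<close>. Irreducibility then selects one of
      the two closed parts.\<close>
    have "F = (F - spectrum_basic_open L a) \<union> (F - spectrum_basic_open L b)"
      using ab spectrum_basic_open_Int[OF lattice_axioms ab(1,2)] by (auto simp: I_def)
    then have "F = F - spectrum_basic_open L a \<or> F = F - spectrum_basic_open L b"
      using irr F(1) ab openin_spectrum_basic_open closedin_diff by metis
    then show ?thesis using ab by (auto simp: I_def)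
  qed
  ultimately have I: "prime_lattice_ideal L I"
    using I_ideal by (auto simp: prime_lattice_ideal_def)
  \<comment> \<open>A point outside the closed set \<open>F\<close> has a neighbourhood
    \<open>d(a)\<close> disjoint from \<open>F\<close>. Then \<open>a\<close> is in \<open>I\<close>
    but not in \<open>J\<close>, so \<open>J\<close> cannot contain \<open>I\<close>.\<close>
  have "J \<in> F" if J: "prime_lattice_ideal L J" "I \<subseteq> J" for J
  proof (rule ccontr)
    assume "J \<notin> F"
    then have "J \<in> topspace ?X - F" using J top by simp
    then obtain a where a: "a \<in> carrier L" "J \<in> spectrum_basic_open L a"
      "spectrum_basic_open L a \<subseteq> topspace ?X - F"
      using prime_spectrum_base F(1) unfolding closedin_def by metis
    then have "a \<in> I" by (auto simp: I_def)
    then show False using J a by (auto simp: spectrum_basic_open_def)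
  qed
  then have "F = ?X closure_of {I}"
    using closure_of_prime_spectrum[OF I] Fp mem by blast
  \<comment> \<open>Equal closures put each of the two ideals above the other.\<close>
  moreover have "J = I" if "prime_lattice_ideal L J" "?X closure_of {J} = ?X closure_of {I}" for J
    using that I closure_of_prime_spectrum by blast
  ultimately show "\<exists>!I. I \<in> topspace ?X \<and> F = ?X closure_of {I}"
    using I top by blast
qed

lemma up_spectral_prime_spectrum: "up_spectral_space (prime_spectrum L)"
  using coherent_prime_spectrum sober_prime_spectrum by (simp add: up_spectral_space_def)

end

section \<open>Homeomorphism invariance\<close>

lemma homeomorphic_coherent_space:
  assumes "X homeomorphic_space Y" "coherent_space X"
  shows "coherent_space Y"
proof -
  obtain f where f: "homeomorphic_map X Y f"
    using assms(1) homeomorphic_space by blast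
  then have inj: "inj_on f (topspace X)" and surj: "f ` topspace X = topspace Y"
    by (auto simp: homeomorphic_map_def homeomorphic_imp_surjective_map[OF f])
  obtain \<B> where base: "openin X = arbitrary union_of (\<lambda>U. U \<in> \<B>)"
    and comp: "\<And>U. U \<in> \<B> \<Longrightarrow> compactin X U"
    and Int: "\<And>\<F>. finite \<F> \<Longrightarrow> \<F> \<noteq> {} \<Longrightarrow> \<F> \<subseteq> \<B> \<Longrightarrow> \<Inter>\<F> \<in> \<B>"
    using assms(2) unfolding coherent_space_def by blast
  note base' = base[unfolded openin_topology_base_unique]
  then have sub: "U \<subseteq> topspace X" if "U \<in> \<B>" for U
    using that openin_subset by blast
  show ?thesis
    unfolding coherent_space_def
  proof (intro exI conjI ballI allI impI)
    show "openin Y = arbitrary union_of (\<lambda>U. U \<in> (`) f ` \<B>)"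
      unfolding openin_topology_base_unique
    proof (intro conjI allI impI)
      show "openin Y V" if "V \<in> (`) f ` \<B>" for V
        using that base' homeomorphic_map_openness_eq[OF f] by blast
      fix V y assume V: "openin Y V \<and> y \<in> V"
      then obtain x where x: "x \<in> topspace X" "y = f x"
        using surj openin_subset by blast
      have "openin X {x \<in> topspace X. f x \<in> V}"
        using V homeomorphic_imp_continuous_map[OF f] by (auto simp: continuous_map)
      then obtain U where "U \<in> \<B>" "x \<in> U" "U \<subseteq> {x \<in> topspace X. f x \<in> V}"
        using base' x V by blast
      then show "\<exists>U. U \<in> (`) f ` \<B> \<and> y \<in> U \<and> U \<subseteq> V"
        using x by blast
    qed
    show "compactin Y V" if "V \<in> (`) f ` \<B>" for V
      using that comp sub homeomorphic_map_compactness[OF f] by blast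
    fix \<F> assume \<F>: "finite \<F> \<and> \<F> \<noteq> {} \<and> \<F> \<subseteq> (`) f ` \<B>"
    then obtain \<G> where \<G>: "\<G> \<subseteq> \<B>" "finite \<G>" "\<F> = (`) f ` \<G>"
      using finite_subset_image by metis
    then obtain U where "U \<in> \<G>" using \<F> by blast
    moreover have "\<forall>U\<in>\<G>. U \<subseteq> topspace X" using \<G> sub by blast
    \<comment> \<open>Image commutes with this intersection because \<open>f\<close> is injective on
      the space, all members lie in the space, and the family has a member \<open>U\<close>.\<close>
    ultimately have "f ` \<Inter>\<G> = \<Inter>\<F>"
      using image_INT[OF inj, of \<G> "\<lambda>U. U" U] \<G>(3) by simp
    moreover have "\<Inter>\<G> \<in> \<B>" using Int \<G> \<F> by blast
    ultimately show "\<Inter>\<F> \<in> (`) f ` \<B>" by blast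
  qed
qed

text \<open>A splitting of the image into two closed sets pulls back along \<open>f\<close> to a
  splitting of \<open>F\<close>. Surjectivity recovers each closed set from its preimage.\<close>

lemma homeomorphic_map_irreducible_closedin:
  assumes f: "homeomorphic_map X Y f" and F: "irreducible_closedin X F"
  shows "irreducible_closedin Y (f ` F)"
proof -
  have inj: "inj_on f (topspace X)" and surj: "f ` topspace X = topspace Y"
    using f by (auto simp: homeomorphic_map_def homeomorphic_imp_surjective_map[OF f])
  have Fs: "F \<subseteq> topspace X" "closedin Y (f ` F)" "F \<noteq> {}"
    using F closedin_subset homeomorphic_map_closedness_eq[OF f]
    by (auto simp: irreducible_closedin_def)
  have "f ` F = G \<or> f ` F = H" if GH: "closedin Y G" "closedin Y H" "f ` F = G \<union> H" for G H
  proof -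
    let ?pre = "\<lambda>S. {x \<in> topspace X. f x \<in> S}"
    have cl: "closedin X (?pre G)" "closedin X (?pre H)"
      using GH homeomorphic_imp_continuous_map[OF f] closedin_continuous_map_preimage by blast+
    have im: "f ` ?pre S = S" if "closedin Y S" for S
      using closedin_subset[OF that] surj[symmetric] by auto
    have "F = ?pre G \<union> ?pre H"
    proof
      show "?pre G \<union> ?pre H \<subseteq> F"
        using GH(3) inj_on_image_mem_iff[OF inj] Fs(1) by blast
    qed (use GH(3) Fs(1) in blast)
    then have "F = ?pre G \<or> F = ?pre H"
      using conjunct2[OF conjunct2[OF F[unfolded irreducible_closedin_def]], rule_format] cl by blast
    then show ?thesis
      using im[OF GH(1)] im[OF GH(2)] by (elim disjE) simp_all
  qed
  then show ?thesis
    using Fs by (auto simp: irreducible_closedin_def)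
qed

text \<open>An irreducible closed set is moved to \<open>X\<close> by the inverse \<open>g\<close>,
  and its generic point there is moved back by \<open>f\<close>. Homeomorphisms commute with
  closures, so existence and uniqueness both transfer.\<close>

lemma homeomorphic_sober_space:
  assumes "X homeomorphic_space Y" "sober_space X"
  shows "sober_space Y"
proof -
  obtain f g where "homeomorphic_maps X Y f g"
    using assms(1) homeomorphic_space_def by blast
  then have f: "homeomorphic_map X Y f" and g: "homeomorphic_map Y X g"
    and fg: "\<And>y. y \<in> topspace Y \<Longrightarrow> f (g y) = y"
    by (auto simp: homeomorphic_maps_map)
  have f_top: "f x \<in> topspace Y" if "x \<in> topspace X" for x
    using that homeomorphic_imp_surjective_map[OF f] by blast
  have g_top: "g y \<in> topspace X" if "y \<in> topspace Y" for y
    using that homeomorphic_imp_surjective_map[OF g] by blast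
  have cl_f: "Y closure_of {f x} = f ` (X closure_of {x})" if "x \<in> topspace X" for x
    using homeomorphic_map_closure_of[OF f, of "{x}"] that by simp
  have cl_g: "X closure_of {g y} = g ` (Y closure_of {y})" if "y \<in> topspace Y" for y
    using homeomorphic_map_closure_of[OF g, of "{y}"] that by simp
  show ?thesis
    unfolding sober_space_def
  proof (intro allI impI)
    fix F assume F: "irreducible_closedin Y F"
    then have "F \<subseteq> topspace Y"
      using closedin_subset by (auto simp: irreducible_closedin_def)
    then have fgF: "f ` g ` F = F"
      using fg by (force simp: image_image subset_iff)
    have ex1: "\<exists>!x. x \<in> topspace X \<and> g ` F = X closure_of {x}"
      using assms(2) homeomorphic_map_irreducible_closedin[OF g F] by (simp add: sober_space_def)
    then obtain x where x: "x \<in> topspace X" "g ` F = X closure_of {x}"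
      by (elim ex1E conjE)
    have uniq: "x' = x" if "x' \<in> topspace X" "g ` F = X closure_of {x'}" for x'
      using ex1 x that by metis
    show "\<exists>!y. y \<in> topspace Y \<and> F = Y closure_of {y}"
    proof (rule ex1I)
      show "f x \<in> topspace Y \<and> F = Y closure_of {f x}"
        using x fgF cl_f f_top by metis
      fix y assume y: "y \<in> topspace Y \<and> F = Y closure_of {y}"
      then have "g y = x" using uniq g_top cl_g by metis
      then show "y = f x" using fg y by metis
    qed
  qed
qed

lemma homeomorphic_up_spectral_space:
  assumes "X homeomorphic_space Y" "up_spectral_space X"
  shows "up_spectral_space Y"
  using assms homeomorphic_coherent_space homeomorphic_sober_space
  unfolding up_spectral_space_def by blast

lemma up_spectral_if_homeomorphic_prime_spectrum:
  assumes "distributive_lattice_bottom L" "Z homeomorphic_space prime_spectrum L"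
  shows "up_spectral_space Z"
  using homeomorphic_up_spectral_space[OF homeomorphic_space_sym[THEN iffD1, OF assms(2)]]
    distributive_lattice_bottom.up_spectral_prime_spectrum[OF assms(1)] .

section \<open>The lattice of compact open sets\<close>

text \<open>Taking \<open>eq\<close> to be equality gives a genuine partial order and not only a
  weak one. The whole space is a member only if it is compact, so the lattice may lack a
  maximum.\<close>

definition compact_open_lattice :: "'a topology \<Rightarrow> 'a set gorder" where
  "compact_open_lattice X = \<lparr>carrier = {U. openin X U \<and> compactin X U}, eq = (=), le = (\<subseteq>)\<rparr>"

lemma compact_open_lattice_simps [simp]:
  "U \<in> carrier (compact_open_lattice X) \<longleftrightarrow> openin X U \<and> compactin X U"
  "le (compact_open_lattice X) = (\<subseteq>)"
  "eq (compact_open_lattice X) = (=)"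
  by (simp_all add: compact_open_lattice_def)

lemma coherent_space_base:
  assumes "coherent_space X" "openin X U" "x \<in> U"
  obtains V where "openin X V" "compactin X V" "x \<in> V" "V \<subseteq> U"
proof -
  obtain \<B> where "openin X = arbitrary union_of (\<lambda>U. U \<in> \<B>)" "\<forall>U\<in>\<B>. compactin X U"
    using assms(1) unfolding coherent_space_def by blast
  then show thesis
    using that assms(2,3) unfolding openin_topology_base_unique by meson
qed

text \<open>Coherence speaks only of basic sets, but every compact open set is a finite union of
  them. The intersection of two such unions is a finite union of pairwise intersections, which are
  basic and therefore compact.\<close>

lemma coherent_space_compactin_Int:
  assumes "coherent_space X" "openin X U" "compactin X U" "openin X V" "compactin X V"
  shows "compactin X (U \<inter> V)"
proof -
  obtain \<B> where base: "openin X = arbitrary union_of (\<lambda>U. U \<in> \<B>)"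
    and comp: "\<And>U. U \<in> \<B> \<Longrightarrow> compactin X U"
    and Int: "\<And>\<F>. finite \<F> \<Longrightarrow> \<F> \<noteq> {} \<Longrightarrow> \<F> \<subseteq> \<B> \<Longrightarrow> \<Inter>\<F> \<in> \<B>"
    using assms(1) unfolding coherent_space_def by blast
  note base' = base[unfolded openin_topology_base_unique]
  have fin: "\<exists>\<F>. finite \<F> \<and> \<F> \<subseteq> \<B> \<and> U = \<Union>\<F>" if U: "openin X U" "compactin X U" for U
  proof -
    \<comment> \<open>The basic sets inside \<open>U\<close> cover it because \<open>U\<close> is
      open; compactness leaves finitely many of them.\<close>
    let ?\<U> = "{B \<in> \<B>. B \<subseteq> U}"
    have "U \<subseteq> \<Union>?\<U>" using base' U by blast
    moreover have "\<And>B. B \<in> ?\<U> \<Longrightarrow> openin X B" using base' by blast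
    ultimately obtain \<F> where "finite \<F>" "\<F> \<subseteq> ?\<U>" "U \<subseteq> \<Union>\<F>"
      using compactinD[OF U(2), of ?\<U>] by blast
    then show ?thesis by blast
  qed
  obtain \<F> where \<F>: "finite \<F>" "\<F> \<subseteq> \<B>" "U = \<Union>\<F>" using fin assms by blast
  obtain \<G> where \<G>: "finite \<G>" "\<G> \<subseteq> \<B>" "V = \<Union>\<G>" using fin assms by blast
  have "U \<inter> V = \<Union>((\<lambda>(A, B). A \<inter> B) ` (\<F> \<times> \<G>))"
    using \<F> \<G> by auto
  moreover have "compactin X (A \<inter> B)" if "A \<in> \<F>" "B \<in> \<G>" for A B
    using that Int[of "{A, B}"] comp \<F> \<G> by auto
  ultimately show ?thesis
    using \<F>(1) \<G>(1) by (auto intro!: compactin_Union)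
qed

lemma compact_open_lattice_Un:
  assumes "U \<in> carrier (compact_open_lattice X)" "V \<in> carrier (compact_open_lattice X)"
  shows "least (compact_open_lattice X) (U \<union> V) (Upper (compact_open_lattice X) {U, V})"
  using assms by (auto simp: least_def Upper_def compactin_Un)

lemma compact_open_lattice_Int:
  assumes "coherent_space X"
    and "U \<in> carrier (compact_open_lattice X)" "V \<in> carrier (compact_open_lattice X)"
  shows "greatest (compact_open_lattice X) (U \<inter> V) (Lower (compact_open_lattice X) {U, V})"
  using assms by (auto simp: greatest_def Lower_def coherent_space_compactin_Int)

lemma lattice_compact_open_lattice:
  assumes "coherent_space X"
  shows "lattice (compact_open_lattice X)"
proof -
  interpret partial_order "compact_open_lattice X"
    by unfold_locales auto
  show ?thesis
    using compact_open_lattice_Un compact_open_lattice_Int[OF assms]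
    by unfold_locales blast+
qed

lemma join_compact_open_lattice:
  assumes "coherent_space X"
    and "U \<in> carrier (compact_open_lattice X)" "V \<in> carrier (compact_open_lattice X)"
  shows "U \<squnion>\<^bsub>compact_open_lattice X\<^esub> V = U \<union> V"
proof -
  interpret lattice "compact_open_lattice X"
    using lattice_compact_open_lattice[OF assms(1)] .
  show ?thesis
    using sup_of_two_least[OF assms(2,3)] compact_open_lattice_Un[OF assms(2,3)] least_unique
    unfolding join_def by blast
qed

lemma meet_compact_open_lattice:
  assumes "coherent_space X"
    and "U \<in> carrier (compact_open_lattice X)" "V \<in> carrier (compact_open_lattice X)"
  shows "U \<sqinter>\<^bsub>compact_open_lattice X\<^esub> V = U \<inter> V"
proof -
  interpret lattice "compact_open_lattice X"
    using lattice_compact_open_lattice[OF assms(1)] .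
  show ?thesis
    using inf_of_two_greatest[OF assms(2,3)] compact_open_lattice_Int[OF assms] greatest_unique
    unfolding meet_def by blast
qed

lemma distributive_compact_open_lattice:
  assumes "coherent_space X"
  shows "distributive_lattice_bottom (compact_open_lattice X)"
proof -
  let ?L = "compact_open_lattice X"
  interpret lattice ?L
    using lattice_compact_open_lattice[OF assms] .
  have "least ?L {} (carrier ?L)"
    by (auto simp: least_def)
  moreover have "U \<sqinter>\<^bsub>?L\<^esub> (V \<squnion>\<^bsub>?L\<^esub> W) = (U \<sqinter>\<^bsub>?L\<^esub> V) \<squnion>\<^bsub>?L\<^esub> (U \<sqinter>\<^bsub>?L\<^esub> W)"
    if "U \<in> carrier ?L" "V \<in> carrier ?L" "W \<in> carrier ?L" for U V W
  proof -
    have "V \<squnion>\<^bsub>?L\<^esub> W \<in> carrier ?L" "U \<sqinter>\<^bsub>?L\<^esub> V \<in> carrier ?L" "U \<sqinter>\<^bsub>?L\<^esub> W \<in> carrier ?L"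
      using that by (simp_all only: join_closed meet_closed)
    then show ?thesis
      using that
      by (simp only: join_compact_open_lattice[OF assms] meet_compact_open_lattice[OF assms] Int_Un_distrib)
  qed
  ultimately show ?thesis
    by unfold_locales blast+
qed

text \<open>Translation into unions and inclusions, so that later arguments about these ideals are
  purely set-theoretic.\<close>

lemma lattice_ideal_compact_open_iff:
  assumes "coherent_space X"
  shows "lattice_ideal (compact_open_lattice X) I \<longleftrightarrow>
    (\<forall>U\<in>I. openin X U \<and> compactin X U) \<and> I \<noteq> {} \<and>
    (\<forall>U\<in>I. \<forall>V. openin X V \<and> compactin X V \<and> V \<subseteq> U \<longrightarrow> V \<in> I) \<and> (\<forall>U\<in>I. \<forall>V\<in>I. U \<union> V \<in> I)"
proof -
  have join: "(\<forall>U\<in>I. \<forall>V\<in>I. U \<squnion>\<^bsub>compact_open_lattice X\<^esub> V \<in> I) \<longleftrightarrow> (\<forall>U\<in>I. \<forall>V\<in>I. U \<union> V \<in> I)"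
    if "\<forall>U\<in>I. openin X U \<and> compactin X U"
    using that join_compact_open_lattice[OF assms] by simp
  have sub: "I \<subseteq> carrier (compact_open_lattice X) \<longleftrightarrow> (\<forall>U\<in>I. openin X U \<and> compactin X U)"
    by (auto simp: subset_iff)
  have down: "(\<forall>U\<in>I. \<forall>V\<in>carrier (compact_open_lattice X). V \<sqsubseteq>\<^bsub>compact_open_lattice X\<^esub> U \<longrightarrow> V \<in> I) \<longleftrightarrow>
    (\<forall>U\<in>I. \<forall>V. openin X V \<and> compactin X V \<and> V \<subseteq> U \<longrightarrow> V \<in> I)"
    by (simp add: Ball_def imp_conjL)
  show ?thesis
    unfolding lattice_ideal_iff[OF lattice_compact_open_lattice[OF assms]]
    by (rule conj_cong[OF sub]) (simp only: join down)
qed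

lemma prime_lattice_ideal_compact_open_iff:
  assumes "coherent_space X"
  shows "prime_lattice_ideal (compact_open_lattice X) I \<longleftrightarrow>
    lattice_ideal (compact_open_lattice X) I \<and>
    (\<exists>U. openin X U \<and> compactin X U \<and> U \<notin> I) \<and>
    (\<forall>U V. openin X U \<and> compactin X U \<and> openin X V \<and> compactin X V \<and> U \<inter> V \<in> I
      \<longrightarrow> U \<in> I \<or> V \<in> I)"
proof -
  let ?L = "compact_open_lattice X"
  have "(\<forall>U\<in>carrier ?L. \<forall>V\<in>carrier ?L. U \<sqinter>\<^bsub>?L\<^esub> V \<in> I \<longrightarrow> U \<in> I \<or> V \<in> I) \<longleftrightarrow>
    (\<forall>U V. openin X U \<and> compactin X U \<and> openin X V \<and> compactin X V \<and> U \<inter> V \<in> I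
      \<longrightarrow> U \<in> I \<or> V \<in> I)"
    using meet_compact_open_lattice[OF assms] by (auto simp: Ball_def)
  moreover have "I \<noteq> carrier ?L \<longleftrightarrow> (\<exists>U. openin X U \<and> compactin X U \<and> U \<notin> I)"
    if "lattice_ideal ?L I"
  proof -
    have "I \<subseteq> carrier ?L"
      using that by (simp add: lattice_ideal_def)
    then have "I \<noteq> carrier ?L \<longleftrightarrow> (\<exists>U. U \<in> carrier ?L \<and> U \<notin> I)" by blast
    then show ?thesis by simp
  qed
  ultimately show ?thesis
    unfolding prime_lattice_ideal_def by (intro conj_cong) simp_all
qed

text \<open>By compactness \<open>U\<close> is covered by finitely many members of the ideal. Their
  union is a member, and so is \<open>U\<close> below it. Thus an ideal of compact open sets is
  determined by its union.\<close>

lemma lattice_ideal_compact_open_Union: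
  assumes "coherent_space X" "lattice_ideal (compact_open_lattice X) I"
    and "openin X U" "compactin X U" "U \<subseteq> \<Union>I"
  shows "U \<in> I"
proof -
  note I = assms(2)[unfolded lattice_ideal_compact_open_iff[OF assms(1)]]
  obtain \<F> where \<F>: "finite \<F>" "\<F> \<subseteq> I" "U \<subseteq> \<Union>\<F>"
    using compactinD[OF assms(4), of I] I assms(5) by auto
  \<comment> \<open>The finite subcover may be empty, so the induction over it has to start from the
    empty union.\<close>
  have empty: "{} \<in> I" using I by auto
  have Un: "V \<union> W \<in> I" if "V \<in> I" "W \<in> I" for V W
    using I that by blast
  have "\<Union>\<F> \<in> I"
    using \<F>(1,2) by induction (simp_all add: empty Un)
  moreover have "V \<in> I" if "W \<in> I" "openin X V" "compactin X V" "V \<subseteq> W" for V W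
    using I that by blast
  ultimately show ?thesis using assms(3,4) \<F>(3) by simp
qed

section \<open>Points of the space as prime ideals\<close>

definition point_ideal :: "'a topology \<Rightarrow> 'a \<Rightarrow> 'a set set" where
  "point_ideal X x = {U. openin X U \<and> compactin X U \<and> x \<notin> U}"

lemma prime_point_ideal:
  assumes "coherent_space X" "x \<in> topspace X"
  shows "prime_lattice_ideal (compact_open_lattice X) (point_ideal X x)"
proof -
  \<comment> \<open>A compact open neighbourhood of \<open>x\<close> is not in the ideal, which
    makes the ideal proper.\<close>
  obtain U where "openin X U" "compactin X U" "x \<in> U"
    using coherent_space_base[OF assms(1) openin_topspace assms(2)] by metis
  moreover have "{} \<in> point_ideal X x" by (simp add: point_ideal_def)
  ultimately show ?thesis
    unfolding prime_lattice_ideal_compact_open_iff[OF assms(1)]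
      lattice_ideal_compact_open_iff[OF assms(1)]
    using coherent_space_compactin_Int[OF assms(1)] by (auto simp: point_ideal_def compactin_Un)
qed

text \<open>The closure of a point is irreducible: whichever of two closed parts contains the point
  contains its closure. The uniqueness clause of sobriety then applies.\<close>

lemma sober_space_closure_of_inj:
  assumes "sober_space X" "x \<in> topspace X" "y \<in> topspace X"
    and eq: "X closure_of {x} = X closure_of {y}"
  shows "x = y"
proof -
  have "G \<union> H = G \<or> G \<union> H = H"
    if "closedin X G" "closedin X H" "X closure_of {x} = G \<union> H" for G H
  proof -
    have "x \<in> G \<union> H"
      using closure_of_subset[of "{x}" X] assms(2) that by auto
    then have "X closure_of {x} \<subseteq> G \<or> X closure_of {x} \<subseteq> H"
      using closure_of_minimal[of "{x}"] that by auto
    then show ?thesis using that by blast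
  qed
  then have "irreducible_closedin X (X closure_of {x})"
    unfolding irreducible_closedin_def
    using assms(2) closure_of_subset[of "{x}" X] by auto
  then show ?thesis
    using assms unfolding sober_space_def by blast
qed

text \<open>Points with the same ideal lie in the same compact open sets. These form a basis, so the
  points lie in the same open sets and have equal closures.\<close>

lemma inj_on_point_ideal:
  assumes "coherent_space X" "sober_space X"
  shows "inj_on (point_ideal X) (topspace X)"
proof (rule inj_onI)
  fix x y assume xy: "x \<in> topspace X" "y \<in> topspace X" and eq: "point_ideal X x = point_ideal X y"
  have iff: "x \<in> U \<longleftrightarrow> y \<in> U" if "openin X U" "compactin X U" for U
    using eq[THEN eqset_imp_iff, of U] that by (simp add: point_ideal_def)
  have "x \<in> U \<longleftrightarrow> y \<in> U" if "openin X U" for U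
    using coherent_space_base[OF assms(1) that] iff subsetD by metis
  then have "X closure_of {x} = X closure_of {y}"
    by (auto simp: closure_of_def)
  then show "x = y"
    using sober_space_closure_of_inj[OF assms(2) xy] by blast
qed

text \<open>Let \<open>F\<close> be the complement of the union of \<open>I\<close>. By compactness
  a compact open set belongs to \<open>I\<close> exactly when it misses \<open>F\<close>. Primality
  of \<open>I\<close> makes \<open>F\<close> irreducible, and since an open set meets the closure of
  \<open>x\<close> exactly when it contains \<open>x\<close>, the generic point of \<open>F\<close>
  has ideal \<open>I\<close>.\<close>

lemma surj_point_ideal:
  assumes coh: "coherent_space X" and sob: "sober_space X"
    and prime: "prime_lattice_ideal (compact_open_lattice X) I"
  shows "I \<in> point_ideal X ` topspace X"
proof -
  note P = prime[unfolded prime_lattice_ideal_compact_open_iff[OF coh]]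
  note I = P[THEN conjunct1, unfolded lattice_ideal_compact_open_iff[OF coh]]
  have mem_iff: "U \<in> I \<longleftrightarrow> U \<subseteq> \<Union>I" if "openin X U" "compactin X U" for U
    using lattice_ideal_compact_open_Union[OF coh] P that by blast
  define F where "F = topspace X - \<Union>I"
  have I_open: "\<And>U. U \<in> I \<Longrightarrow> openin X U \<and> compactin X U"
    using I by simp
  obtain W where W: "openin X W" "compactin X W" "W \<notin> I"
    using P by blast
  have I_prime: "U \<in> I \<or> V \<in> I"
    if "openin X U" "compactin X U" "openin X V" "compactin X V" "U \<inter> V \<in> I" for U V
    using P[THEN conjunct2, THEN conjunct2] that by simp
  have "openin X (\<Union>I)" using I_open by (simp add: openin_Union)
  then have clF: "closedin X F" by (simp add: F_def closedin_diff)
  \<comment> \<open>A point of \<open>F\<close> outside \<open>G\<close> has a compact open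
    neighbourhood that misses \<open>G\<close>. This neighbourhood meets \<open>F\<close>, so it is
    not in \<open>I\<close>.\<close>
  have meets: "\<exists>U. openin X U \<and> compactin X U \<and> U \<inter> G = {} \<and> U \<notin> I"
    if G: "closedin X G" "G \<subseteq> F" "G \<noteq> F" for G
  proof -
    have "F \<subseteq> topspace X" by (auto simp: F_def)
    then obtain x where x: "x \<in> F" "x \<in> topspace X - G" using G by blast
    then obtain U where "openin X U" "compactin X U" "x \<in> U" "U \<subseteq> topspace X - G"
      using coherent_space_base[OF coh] G(1) unfolding closedin_def by metis
    then show ?thesis using x by (intro exI[of _ U]) (auto simp: F_def)
  qed
  have "irreducible_closedin X F"
    unfolding irreducible_closedin_def
  proof (intro conjI allI impI)
    show "F \<noteq> {}"
    proof
      assume "F = {}"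
      then have "topspace X \<subseteq> \<Union>I" by (auto simp: F_def)
      then show False using W mem_iff[OF W(1,2)] openin_subset[OF W(1)] by simp
    qed
    fix G H assume GH: "closedin X G \<and> closedin X H \<and> F = G \<union> H"
    show "F = G \<or> F = H"
    proof (rule ccontr)
      assume "\<not> (F = G \<or> F = H)"
      then obtain U V where U: "openin X U" "compactin X U" "U \<inter> G = {}" "U \<notin> I"
        and V: "openin X V" "compactin X V" "V \<inter> H = {}" "V \<notin> I"
        using meets[of G] meets[of H] GH by blast
      \<comment> \<open>\<open>U\<close> misses \<open>G\<close> and \<open>V\<close> misses
        \<open>H\<close>, so their intersection misses the union \<open>F\<close> of
        \<open>G\<close> and \<open>H\<close>.\<close>
      have "U \<inter> V \<subseteq> \<Union>I"
        using U V GH openin_subset[OF U(1)] unfolding F_def by blast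
      then have "U \<inter> V \<in> I"
        using mem_iff[OF openin_Int[OF U(1) V(1)] coherent_space_compactin_Int[OF coh U(1,2) V(1,2)]]
        by blast
      then show False using I_prime[OF U(1,2) V(1,2)] U(4) V(4) by simp
    qed
  qed (fact clF)
  then obtain x where x: "x \<in> topspace X" "F = X closure_of {x}"
    using sob unfolding sober_space_def by blast
  have "U \<in> I \<longleftrightarrow> x \<notin> U" if "openin X U" "compactin X U" for U
  proof -
    have "U \<in> I \<longleftrightarrow> U \<inter> F = {}"
      using mem_iff[OF that] openin_subset[OF that(1)] by (auto simp: F_def)
    also have "\<dots> \<longleftrightarrow> x \<notin> U"
      using openin_Int_closure_of_eq_empty[OF that(1), of "{x}"] x by auto
    finally show ?thesis .
  qed
  then have "I = point_ideal X x"
    using I_open by (auto simp: point_ideal_def)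
  then show ?thesis using x by simp
qed

text \<open>The map is a bijection under which \<open>U\<close> corresponds to the basic open set of
  \<open>U\<close>, for each compact open \<open>U\<close>. Both families are bases, which gives
  continuity and openness.\<close>

lemma homeomorphic_map_point_ideal:
  assumes coh: "coherent_space X" and sob: "sober_space X"
  shows "homeomorphic_map X (prime_spectrum (compact_open_lattice X)) (point_ideal X)"
proof (rule bijective_open_imp_homeomorphic_map)
  let ?L = "compact_open_lattice X"
  have lat: "lattice ?L" using lattice_compact_open_lattice[OF coh] .
  interpret distributive_lattice_bottom ?L
    using distributive_compact_open_lattice[OF coh] .
  have im_top: "point_ideal X ` topspace X = topspace (prime_spectrum ?L)"
    using prime_point_ideal[OF coh] surj_point_ideal[OF coh sob]
    by (auto simp: topspace_prime_spectrum[OF lat])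
  then show "point_ideal X ` topspace X = topspace (prime_spectrum ?L)" .
  show "inj_on (point_ideal X) (topspace X)"
    using inj_on_point_ideal[OF coh sob] .
  have mem_iff: "point_ideal X x \<in> spectrum_basic_open ?L U \<longleftrightarrow> x \<in> U"
    if "x \<in> topspace X" "openin X U" "compactin X U" for x U
    using that prime_point_ideal[OF coh] by (auto simp: spectrum_basic_open_def point_ideal_def)
  have "openin X {x \<in> topspace X. point_ideal X x \<in> spectrum_basic_open ?L U}"
    if "openin X U" "compactin X U" for U
  proof -
    have "{x \<in> topspace X. point_ideal X x \<in> spectrum_basic_open ?L U} = U"
      using mem_iff that openin_subset[OF that(1)] by auto
    then show ?thesis using that by simp
  qed
  then show "continuous_map X (prime_spectrum ?L) (point_ideal X)"
    using im_top
    by (auto intro!: continuous_map_into_topology_base[OF openin_prime_spectrum[OF lat]])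
  show "open_map X (prime_spectrum ?L) (point_ideal X)"
    unfolding open_map_def
  proof (intro allI impI)
    fix W assume W: "openin X W"
    show "openin (prime_spectrum ?L) (point_ideal X ` W)"
    proof (subst openin_subopen, intro ballI)
      fix I assume "I \<in> point_ideal X ` W"
      then obtain x where x: "x \<in> W" "I = point_ideal X x" by blast
      obtain U where U: "openin X U" "compactin X U" "x \<in> U" "U \<subseteq> W"
        using coherent_space_base[OF coh W x(1)] .
      \<comment> \<open>By surjectivity every prime ideal in this basic set comes from a point, and
        that point lies in \<open>U\<close> by \<open>mem_iff\<close>.\<close>
      have "spectrum_basic_open ?L U \<subseteq> point_ideal X ` W"
      proof
        fix J assume J: "J \<in> spectrum_basic_open ?L U"
        then obtain y where "y \<in> topspace X" "J = point_ideal X y"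
          using surj_point_ideal[OF coh sob] by (auto simp: spectrum_basic_open_def)
        then show "J \<in> point_ideal X ` W"
          using J U mem_iff by blast
      qed
      moreover have "I \<in> spectrum_basic_open ?L U"
        using mem_iff U x openin_subset[OF U(1)] by auto
      moreover have "openin (prime_spectrum ?L) (spectrum_basic_open ?L U)"
        using openin_spectrum_basic_open U by simp
      ultimately show "\<exists>T. openin (prime_spectrum ?L) T \<and> I \<in> T \<and> T \<subseteq> point_ideal X ` W"
        by blast
    qed
  qed
qed

text \<open>A lattice cannot be quantified over all carrier types inside a formula. The equivalence
  therefore names the type \<open>'a set\<close>, where the compact open sets live, and the second
  conjunct gives the implication to up-spectrality for a lattice over an arbitrary type
  \<open>'b\<close>.\<close>

theorem corollary2:
  fixes Z :: "'a topology"
  shows "(up_spectral_space Z \<longleftrightarrow>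
            (\<exists>L :: 'a set gorder.
               distributive_lattice_bottom L \<and> Z homeomorphic_space prime_spectrum L)) \<and>
         ((\<exists>L :: 'b gorder.
               distributive_lattice_bottom L \<and> Z homeomorphic_space prime_spectrum L)
            \<longrightarrow> up_spectral_space Z)"
proof (intro conjI iffI impI)
  show "up_spectral_space Z"
    if "\<exists>L :: 'a set gorder. distributive_lattice_bottom L \<and> Z homeomorphic_space prime_spectrum L"
    using up_spectral_if_homeomorphic_prime_spectrum that by blast
  show "up_spectral_space Z"
    if "\<exists>L :: 'b gorder. distributive_lattice_bottom L \<and> Z homeomorphic_space prime_spectrum L"
    using up_spectral_if_homeomorphic_prime_spectrum that by blast
  assume "up_spectral_space Z"
  then show "\<exists>L :: 'a set gorder. distributive_lattice_bottom L \<and> Z homeomorphic_space prime_spectrum L"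
    using distributive_compact_open_lattice homeomorphic_map_point_ideal
      homeomorphic_map_imp_homeomorphic_space
    unfolding up_spectral_space_def by blast
qed

end
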